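(* For $\gamma>0$ and $n=1,\ldots,N$, the moment generating function of the approximated headway $H^{(n)}_{\mathrm{Normal}}$ is $$\begin{aligned}M_{H^{(n)}_{\mathrm{Normal}}}(t)=\ &\Phi\left(\frac{-\left(\overline H\theta+\frac{2\gamma T^{(N)}}{\overline F}\right)}{2\sqrt{T^{(n)}\gamma}}\right)\\&+e^{t\left(\overline H+\frac{2\gamma T^{(N)}}{\theta\overline F}\right)}e^{\gamma T^{(n)}\frac{2t^2}{\theta^2}}\left[1-\Phi\left(\frac{-\left(\overline H\theta+\frac{2\gamma T^{(N)}}{\overline F}\right)}{2\sqrt{T^{(n)}\gamma}}-\frac{2t\sqrt{T^{(n)}\gamma}}{\theta}\right)\right].\end{aligned}$$ Here $\Phi$ is the standard normal cumulative distribution function (and its analytic continuation for complex arguments). When $\gamma=0$, $H^{(n)}_{\mathrm{Normal}}=\overline H$ almost surely and $M_{H^{(n)}_{\mathrm{Normal}}}(t)=e^{t\overline H}$.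
   Context: Constants: nominal scheduled headway $\overline H>0$, route fleet size $\overline F>0$, incident rate $\gamma\ge0$, incident recovery rate $\theta>0$, and incident-free travel times $T^{(n)}>0$ from the hub to station $n$ ($n=1,\ldots,N$). $\widehat H^{(n)}_{\mathrm{Normal}}$ is a normal random variable with mean $\mu=\overline H+\frac{2\gamma T^{(N)}}{\theta\overline F}$ and standard deviation $\sigma=\frac{2\sqrt{T^{(n)}\gamma}}{\theta}$ (degenerate at $\overline H$ if $\gamma=0$), and the approximated headway is its positive part $H^{(n)}_{\mathrm{Normal}}=\max\{0,\widehat H^{(n)}_{\mathrm{Normal}}\}$. The moment generating function is $M_X(t)=\mathbb{E}[e^{tX}]$. *)

theory Defs
  imports "HOL-Probability.Probability" "HOL-Complex_Analysis.Complex_Analysis"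
begin

definition std_normal_cdf :: "real \<Rightarrow> real" where
  "std_normal_cdf x = cdf std_normal_distribution x"

(* The analytic continuation is pinned down by its defining property; that exactly one such
   function exists is std_normal_cdf_continuation_unique below. *)
definition is_std_normal_cdf_continuation :: "(complex \<Rightarrow> complex) \<Rightarrow> bool" where
  "is_std_normal_cdf_continuation f \<longleftrightarrow>
     f holomorphic_on UNIV \<and> (\<forall>x::real. f (of_real x) = of_real (std_normal_cdf x))"

definition std_normal_cdf_complex :: "complex \<Rightarrow> complex" where
  "std_normal_cdf_complex = (THE f. is_std_normal_cdf_continuation f)"

(* Used both for real t and for complex t. *)
definition mgf :: "'a measure \<Rightarrow> ('a \<Rightarrow> real) \<Rightarrow> 't \<Rightarrow> 't::{banach,second_countable_topology,real_normed_field}" where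
  "mgf M X t = (\<integral>\<omega>. exp (t * of_real (X \<omega>)) \<partial>M)"

(* The Bochner integral is 0 for non-integrable functions, so finiteness of the moment
   generating function has to be asserted separately. *)
definition mgf_exists :: "'a measure \<Rightarrow> ('a \<Rightarrow> real) \<Rightarrow> 't::{banach,second_countable_topology,real_normed_field} \<Rightarrow> bool" where
  "mgf_exists M X t \<longleftrightarrow> integrable M (\<lambda>\<omega>. exp (t * of_real (X \<omega>)))"

(* H: nominal headway, F: fleet size, \<gamma>: incident rate, \<theta>: recovery rate,
   T n: incident-free travel time to station n (N is the last station). *)
definition headway_mean :: "real \<Rightarrow> real \<Rightarrow> real \<Rightarrow> real \<Rightarrow> (nat \<Rightarrow> real) \<Rightarrow> nat \<Rightarrow> real" where
  "headway_mean H F \<gamma> \<theta> T N = H + 2 * \<gamma> * T N / (\<theta> * F)"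

definition headway_sd :: "real \<Rightarrow> real \<Rightarrow> (nat \<Rightarrow> real) \<Rightarrow> nat \<Rightarrow> real" where
  "headway_sd \<gamma> \<theta> T n = 2 * sqrt (T n * \<gamma>) / \<theta>"

definition approx_headway :: "('a \<Rightarrow> real) \<Rightarrow> 'a \<Rightarrow> real" where
  "approx_headway X \<omega> = max 0 (X \<omega>)"

lemma std_normal_cdf_diff:
  fixes F :: "complex \<Rightarrow> complex"
  assumes F: "\<And>z. (F has_field_derivative exp (- z\<^sup>2 / 2) / of_real (sqrt (2 * pi))) (at z)"
    and ab: "a < b"
  shows "F (of_real b) - F (of_real a) = of_real (std_normal_cdf b - std_normal_cdf a)"
proof -
  interpret real_distribution std_normal_distribution
    by (rule real_dist_normal_dist)
  have dens: "exp (- (of_real x)\<^sup>2 / 2) / of_real (sqrt (2 * pi)) = (of_real (std_normal_density x) :: complex)" for x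
    by (simp add: std_normal_density_def flip: exp_of_real)
  have "((\<lambda>x. F (of_real x)) has_vector_derivative of_real (std_normal_density x)) (at x within {a..b})" for x
    using has_vector_derivative_real_field[OF F[of "of_real x"], of "{a..b}"]
    unfolding dens .
  then have 1: "((\<lambda>x. of_real (std_normal_density x)) has_integral (F (of_real b) - F (of_real a))) {a..b}"
    using ab by (intro fundamental_theorem_of_calculus) auto
  have cont: "continuous_on {a..b} std_normal_density"
    unfolding std_normal_density_def by (intro continuous_intros) auto
  then have int: "std_normal_density integrable_on {a..b}"
    by (rule integrable_continuous_real)
  then have 2: "((\<lambda>x. of_real (std_normal_density x) :: complex) has_integral of_real (integral {a..b} std_normal_density)) {a..b}"
    by (intro has_integral_of_real integrable_integral)
  have nn: "emeasure std_normal_distribution {a<..b} = ennreal (integral {a..b} std_normal_density)"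
  proof -
    have "emeasure std_normal_distribution {a<..b}
        = (\<integral>\<^sup>+x. ennreal (std_normal_density x) * indicator {a<..b} x \<partial>lborel)"
      by (subst emeasure_density) auto
    also have "\<dots> = (\<integral>\<^sup>+x. ennreal (std_normal_density x) * indicator {a..b} x \<partial>lborel)"
      using AE_lborel_singleton[of a]
      by (intro nn_integral_cong_AE) (auto simp: indicator_def elim!: eventually_mono)
    also have "\<dots> = ennreal (integral {a..b} std_normal_density)"
      using int by (intro nn_integral_has_integral_lebesgue' integrable_integral) auto
    finally show ?thesis .
  qed
  have "std_normal_cdf b - std_normal_cdf a = measure std_normal_distribution {a<..b}"
    unfolding std_normal_cdf_def using ab by (rule cdf_diff_eq)
  also have "\<dots> = integral {a..b} std_normal_density"
    unfolding measure_def nn by (intro enn2real_ennreal integral_nonneg int) auto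
  finally show ?thesis
    using has_integral_unique[OF 1 2] by simp
qed

lemma std_normal_cdf_continuation_unique: "\<exists>!f. is_std_normal_cdf_continuation f"
proof (rule ex_ex1I)
  have "(\<lambda>z::complex. exp (- z\<^sup>2 / 2) / of_real (sqrt (2 * pi))) holomorphic_on UNIV"
    by (intro holomorphic_intros) auto
  then obtain F where "\<And>z::complex. z \<in> UNIV \<Longrightarrow>
      (F has_field_derivative exp (- z\<^sup>2 / 2) / of_real (sqrt (2 * pi))) (at z within UNIV)"
    using holomorphic_convex_primitive'[of UNIV] by (metis convex_UNIV open_UNIV)
  then have F: "(F has_field_derivative exp (- z\<^sup>2 / 2) / of_real (sqrt (2 * pi))) (at z)" for z
    by simp
  define f where "f z = F z - F 0 + of_real (std_normal_cdf 0)" for z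
  have "F holomorphic_on UNIV"
    using F by (auto simp: holomorphic_on_def field_differentiable_def)
  then have "f holomorphic_on UNIV"
    unfolding f_def by (intro holomorphic_intros)
  moreover have "f (of_real x) = of_real (std_normal_cdf x)" for x :: real
  proof -
    consider "x < 0" | "x = 0" | "x > 0" by linarith
    then show ?thesis
    proof cases
      case 1
      have "f (of_real x) = of_real (std_normal_cdf 0) - (F (of_real 0) - F (of_real x))"
        by (simp add: f_def)
      also have "\<dots> = of_real (std_normal_cdf x)"
        unfolding std_normal_cdf_diff[OF F 1] by simp
      finally show ?thesis .
    next
      case 2
      then show ?thesis by (simp add: f_def)
    next
      case 3
      have "f (of_real x) = (F (of_real x) - F (of_real 0)) + of_real (std_normal_cdf 0)"
        by (simp add: f_def)
      also have "\<dots> = of_real (std_normal_cdf x)"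
        unfolding std_normal_cdf_diff[OF F 3] by simp
      finally show ?thesis .
    qed
  qed
  ultimately show "\<exists>f. is_std_normal_cdf_continuation f"
    by (auto simp: is_std_normal_cdf_continuation_def)
next
  fix f g :: "complex \<Rightarrow> complex"
  assume fg: "is_std_normal_cdf_continuation f" "is_std_normal_cdf_continuation g"
  have lim: "(0::complex) islimpt range of_real"
  proof (rule islimptI)
    fix S :: "complex set" assume "0 \<in> S" "open S"
    then obtain e where e: "e > 0" "ball 0 e \<subseteq> S"
      by (meson openE)
    then have "of_real (e / 2) \<in> S" "of_real (e / 2) \<noteq> (0::complex)"
      by (auto simp: subset_iff)
    then show "\<exists>y\<in>range of_real. y \<in> S \<and> y \<noteq> (0::complex)"
      by blast
  qed
  have "f z - g z = 0" for z
    using fg by (intro analytic_continuation[of "\<lambda>z. f z - g z" UNIV "range of_real" 0 z] lim)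
      (auto simp: is_std_normal_cdf_continuation_def intro!: holomorphic_intros)
  then show "f = g" by auto
qed

end

theory Submission
  imports Defs "HOL-Real_Asymp.Real_Asymp"
begin

text \<open>For complex \<open>w\<close> the function \<open>e\<^sup>w\<^sup>x \<phi>(x)\<close>, \<open>\<phi>\<close> the standard normal density, has the
  antiderivative \<open>exp (w\<^sup>2/2) \<Phi>(x - w)\<close> on the real line, where \<open>\<Phi>\<close> is the entire continuation of
  the normal distribution function. Since \<open>\<Phi>(x - w)\<close> tends to \<open>1\<close> as \<open>x\<close> goes to infinity, the
  Gaussian tail integrals have a closed form for complex exponents, without a separate continuation
  in \<open>t\<close>, and the real moment generating function is a special case. The event where the
  positive part vanishes contributes the first summand of the formula.\<close>

section \<open>The entire continuation of the normal distribution function\<close>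

lemma std_normal_cdf_continuation_complex:
  "is_std_normal_cdf_continuation std_normal_cdf_complex"
  unfolding std_normal_cdf_complex_def
  by (rule theI'[OF std_normal_cdf_continuation_unique])

lemma std_normal_cdf_complex_of_real:
  "std_normal_cdf_complex (of_real x) = of_real (std_normal_cdf x)"
  using std_normal_cdf_continuation_complex
  by (simp add: is_std_normal_cdf_continuation_def)

text \<open>The continuation is known only through its defining property, so the derivative is
  obtained from a rival candidate: a primitive of the Gaussian, normalised at 0, is also a
  continuation, and uniqueness identifies the two.\<close>

lemma std_normal_cdf_complex_deriv:
  "(std_normal_cdf_complex has_field_derivative exp (- z\<^sup>2 / 2) / of_real (sqrt (2 * pi))) (at z)"
proof -
  have "(\<lambda>z::complex. exp (- z\<^sup>2 / 2) / of_real (sqrt (2 * pi))) holomorphic_on UNIV"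
    by (intro holomorphic_intros) auto
  then obtain F where F: "(F has_field_derivative exp (- z\<^sup>2 / 2) / of_real (sqrt (2 * pi))) (at z)"
    for z :: complex
    using holomorphic_convex_primitive'[of UNIV] by auto
  define G where "G z = F z - F 0 + of_real (std_normal_cdf 0)" for z
  have G: "(G has_field_derivative exp (- z\<^sup>2 / 2) / of_real (sqrt (2 * pi))) (at z)" for z
    unfolding G_def by (rule derivative_eq_intros F refl | simp)+
  \<comment> \<open>\<open>std_normal_cdf_diff\<close> needs strictly ordered endpoints, hence one
    instance for each sign of \<open>x\<close>.\<close>
  have "G (of_real x) = of_real (std_normal_cdf x)" for x :: real
    using std_normal_cdf_diff[OF F, of 0 x] std_normal_cdf_diff[OF F, of x 0]
    by (cases x "0::real" rule: linorder_cases) (auto simp: G_def algebra_simps)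
  moreover have "G holomorphic_on UNIV"
    using G by (auto simp: holomorphic_on_def field_differentiable_def)
  ultimately have "is_std_normal_cdf_continuation G"
    by (simp add: is_std_normal_cdf_continuation_def)
  then have "std_normal_cdf_complex = G"
    using std_normal_cdf_continuation_complex std_normal_cdf_continuation_unique by blast
  then show ?thesis
    using G by simp
qed

text \<open>The limit along the real line is transported to a parallel line: on the vertical segment from
  \<open>x - Re w\<close> to \<open>x - w\<close> the derivative of \<open>\<Phi>\<close> decays like \<open>exp (-x\<^sup>2/2)\<close>, up to lower order
  terms in the exponent.\<close>

lemma std_normal_cdf_complex_tendsto_1:
  "((\<lambda>x. std_normal_cdf_complex (of_real x - w)) \<longlongrightarrow> 1) at_top"
proof -
  define r v where "r = Re w" and "v = Im w"
  let ?\<Phi> = std_normal_cdf_complex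
  have bound: "norm (?\<Phi> (of_real x - w) - ?\<Phi> (of_real (x - r)))
      \<le> exp ((v\<^sup>2 - (x - r)\<^sup>2) / 2) / sqrt (2 * pi) * \<bar>v\<bar>" for x
  proof -
    let ?S = "closed_segment (of_real (x - r)) (of_real x - w)"
    have "norm (?\<Phi> (of_real x - w) - ?\<Phi> (of_real (x - r)))
        \<le> exp ((v\<^sup>2 - (x - r)\<^sup>2) / 2) / sqrt (2 * pi) * norm (of_real x - w - of_real (x - r))"
    proof (rule field_differentiable_bound[of ?S])
      fix z assume "z \<in> ?S"
      then obtain u where u: "0 \<le> u" "u \<le> 1"
        "z = (1 - u) *\<^sub>R of_real (x - r) + u *\<^sub>R (of_real x - w)"
        by (auto simp: closed_segment_def)
      \<comment> \<open>The modulus of the derivative depends only on \<open>Re (- z^2 / 2)\<close>.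
        On the segment \<open>Re z\<close> is constant and \<open>Im z\<close> is at most
        \<open>\<bar>v\<bar>\<close> in absolute value, which gives a bound uniform in
        \<open>u\<close>.\<close>
      have z: "Re z = x - r" "Im z = - (u * v)"
        unfolding u(3) by (simp_all add: r_def v_def algebra_simps)
      have "(u * v)\<^sup>2 \<le> v\<^sup>2"
        using u(1,2) by (simp add: power_mult_distrib mult_left_le_one_le power_le_one)
      moreover have "Re (- z\<^sup>2 / 2) = ((Im z)\<^sup>2 - (Re z)\<^sup>2) / 2"
        by (simp add: power2_eq_square diff_divide_distrib)
      ultimately have "Re (- z\<^sup>2 / 2) \<le> (v\<^sup>2 - (x - r)\<^sup>2) / 2"
        unfolding z by simp
      then show "norm (exp (- z\<^sup>2 / 2) / of_real (sqrt (2 * pi)))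
          \<le> exp ((v\<^sup>2 - (x - r)\<^sup>2) / 2) / sqrt (2 * pi)"
        by (simp add: norm_divide divide_right_mono)
      show "(?\<Phi> has_field_derivative exp (- z\<^sup>2 / 2) / of_real (sqrt (2 * pi))) (at z within ?S)"
        by (rule has_field_derivative_at_within[OF std_normal_cdf_complex_deriv])
    qed auto
    also have "of_real x - w - of_real (x - r) = - (\<i> * of_real v)"
      by (simp add: complex_eq_iff r_def v_def)
    finally show ?thesis
      by (simp add: norm_mult)
  qed
  have "((\<lambda>x::real. exp ((v\<^sup>2 - (x - r)\<^sup>2) / 2) / sqrt (2 * pi) * \<bar>v\<bar>) \<longlongrightarrow> 0) at_top"
    by real_asymp
  then have "((\<lambda>x. ?\<Phi> (of_real x - w) - ?\<Phi> (of_real (x - r))) \<longlongrightarrow> 0) at_top"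
    by (rule Lim_null_comparison[rotated]) (use bound in auto)
  moreover have "((\<lambda>x. ?\<Phi> (of_real (x - r))) \<longlongrightarrow> 1) at_top"
  proof -
    interpret real_distribution std_normal_distribution
      by (rule real_dist_normal_dist)
    have "(std_normal_cdf \<longlongrightarrow> 1) at_top"
      unfolding std_normal_cdf_def[abs_def] by (rule cdf_lim_at_top_prob)
    moreover have "filterlim (\<lambda>x. x - r) at_top at_top"
      by real_asymp
    ultimately have "((\<lambda>x. std_normal_cdf (x - r)) \<longlongrightarrow> 1) at_top"
      by (rule filterlim_compose)
    then show ?thesis
      unfolding std_normal_cdf_complex_of_real by (metis tendsto_of_real of_real_1)
  qed
  ultimately show ?thesis
    using tendsto_add by fastforce
qed

section \<open>Gaussian integrals with complex exponents\<close>

text \<open>Only \<open>Re w\<close> enters the norm. Completing the square turns the norm into a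
  constant multiple of the normal density with mean \<open>Re w\<close> and unit variance.\<close>

lemma integrable_std_normal_exp:
  "integrable lborel (\<lambda>x. std_normal_density x *\<^sub>R exp (w * complex_of_real x))"
proof (rule Bochner_Integration.integrable_bound)
  show "integrable lborel (\<lambda>x. exp ((Re w)\<^sup>2 / 2) * normal_density (Re w) 1 x)"
    by simp
  have "std_normal_density x * exp (Re w * x) = exp ((Re w)\<^sup>2 / 2) * normal_density (Re w) 1 x" for x
    by (simp add: normal_density_def flip: exp_add)
      (simp add: power2_eq_square field_simps)
  then show "AE x in lborel. norm (std_normal_density x *\<^sub>R exp (w * complex_of_real x))
      \<le> norm (exp ((Re w)\<^sup>2 / 2) * normal_density (Re w) 1 x)"
    by simp
qed simp

text \<open>This is exponential tilting: for real \<open>w\<close> the weight moves the mean from 0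
  to \<open>w\<close> at the cost of the factor \<open>exp (w^2 / 2)\<close>, so the tail beyond
  \<open>a\<close> becomes the tail beyond \<open>a - w\<close>. The antiderivative \<open>P\<close>
  makes the same formula hold for complex \<open>w\<close>.\<close>

lemma has_bochner_integral_std_normal_exp_tail:
  fixes w :: complex
  shows "has_bochner_integral std_normal_distribution
    (\<lambda>x. indicator {a<..} x *\<^sub>R exp (w * of_real x))
    (exp (w\<^sup>2 / 2) * (1 - std_normal_cdf_complex (of_real a - w)))"
proof -
  let ?\<Phi> = std_normal_cdf_complex
  let ?f = "\<lambda>x. std_normal_density x *\<^sub>R exp (w * complex_of_real x)"
  define P where "P x = exp (w\<^sup>2 / 2) * ?\<Phi> (of_real x - w)" for x :: real
  have f_eq: "?f x = exp (w\<^sup>2 / 2) * (exp (- (of_real x - w)\<^sup>2 / 2) / of_real (sqrt (2 * pi)))" for x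
  proof -
    have "w\<^sup>2 / 2 + - (of_real x - w)\<^sup>2 / 2 = of_real (- x\<^sup>2 / 2) + w * of_real x"
      by (simp add: power2_eq_square field_simps)
    then have "exp (w\<^sup>2 / 2) * exp (- (of_real x - w)\<^sup>2 / 2)
        = of_real (exp (- x\<^sup>2 / 2)) * exp (w * of_real x)"
      unfolding exp_of_real[symmetric] exp_add[symmetric] by (rule arg_cong)
    then show ?thesis
      by (simp add: std_normal_density_def scaleR_conv_of_real)
  qed
  have P: "(P has_vector_derivative ?f x) (at x)" for x
  proof -
    have "((\<lambda>z. exp (w\<^sup>2 / 2) * ?\<Phi> (z - w)) has_field_derivative ?f x) (at (of_real x))"
      unfolding f_eq
      by (rule derivative_eq_intros DERIV_chain2[OF std_normal_cdf_complex_deriv] refl | simp)+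
    from has_vector_derivative_real_field[OF this] show ?thesis
      unfolding P_def .
  qed
  have cont: "isCont ?f x" for x
    unfolding normal_density_def by (intro continuous_intros) simp_all
  have "(P \<longlongrightarrow> exp (w\<^sup>2 / 2) * 1) at_top"
    unfolding P_def by (intro tendsto_intros std_normal_cdf_complex_tendsto_1)
  moreover have "(P \<longlongrightarrow> P a) (at_right a)"
    using has_vector_derivative_continuous[OF P, of a]
    by (simp add: continuous_at filterlim_at_split)
  \<comment> \<open>The fundamental theorem used on the unbounded interval presupposes
    integrability, which is inherited from the whole line.\<close>
  moreover have int: "set_integrable lborel {a<..} ?f"
    by (rule set_integrable_subset[of _ UNIV]) (auto simp: set_integrable_def integrable_std_normal_exp)
  ultimately have "(LBINT x=a..\<infinity>. ?f x) = exp (w\<^sup>2 / 2) * 1 - P a"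
    by (intro interval_integral_FTC_integrable[where F = P])
      (auto simp: ereal_tendsto_simps intro: P cont)
  also have "(LBINT x=a..\<infinity>. ?f x) = (\<integral>x. indicator {a<..} x *\<^sub>R ?f x \<partial>lborel)"
    by (simp add: interval_lebesgue_integral_def set_lebesgue_integral_def)
  finally have "has_bochner_integral lborel (\<lambda>x. indicator {a<..} x *\<^sub>R ?f x) (exp (w\<^sup>2 / 2) * 1 - P a)"
    using int by (simp add: has_bochner_integral_iff set_integrable_def)
  \<comment> \<open>The density is pulled to the front so that it can be absorbed into the
    measure.\<close>
  then have "has_bochner_integral lborel
      (\<lambda>x. std_normal_density x *\<^sub>R (indicator {a<..} x *\<^sub>R exp (w * of_real x)))
      (exp (w\<^sup>2 / 2) * (1 - ?\<Phi> (of_real a - w)))"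
    by (simp add: P_def algebra_simps)
  then show ?thesis
    by (intro has_bochner_integral_density) auto
qed

text \<open>The line is split where \<open>\<mu> + \<sigma> * x\<close> changes sign. To the left
  the integrand is \<open>exp 0 = 1\<close> and contributes a probability; to the right it is
  \<open>exp (t * \<mu>)\<close> times a tail integrand with
  \<open>w = t * \<sigma>\<close>.\<close>

lemma has_bochner_integral_exp_max_normal:
  fixes \<mu> \<sigma> :: real and t :: complex
  assumes "\<sigma> > 0"
  shows "has_bochner_integral std_normal_distribution
    (\<lambda>x. exp (t * of_real (max 0 (\<mu> + \<sigma> * x))))
    (std_normal_cdf_complex (of_real (- \<mu> / \<sigma>)) + exp (t * of_real \<mu>) * exp (t\<^sup>2 * of_real (\<sigma>\<^sup>2) / 2)
      * (1 - std_normal_cdf_complex (of_real (- \<mu> / \<sigma>) - t * of_real \<sigma>)))"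
proof -
  interpret real_distribution std_normal_distribution
    by (rule real_dist_normal_dist)
  define a where "a = - \<mu> / \<sigma>"
  have "has_bochner_integral std_normal_distribution (\<lambda>x. indicator {..a} x *\<^sub>R (1::complex))
      (measure std_normal_distribution {..a} *\<^sub>R 1)"
    by (intro has_bochner_integral_scaleR_left has_bochner_integral_real_indicator)
      (auto simp: emeasure_eq_measure)
  then have "has_bochner_integral std_normal_distribution (\<lambda>x. indicator {..a} x *\<^sub>R (1::complex))
      (std_normal_cdf_complex (of_real a))"
    by (simp add: std_normal_cdf_complex_of_real std_normal_cdf_def cdf_def scaleR_conv_of_real)
  moreover have "has_bochner_integral std_normal_distribution
      (\<lambda>x. exp (t * of_real \<mu>) * (indicator {a<..} x *\<^sub>R exp (t * of_real \<sigma> * of_real x)))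
      (exp (t * of_real \<mu>) * (exp ((t * of_real \<sigma>)\<^sup>2 / 2)
        * (1 - std_normal_cdf_complex (of_real a - t * of_real \<sigma>))))"
    by (intro has_bochner_integral_mult_right has_bochner_integral_std_normal_exp_tail)
  ultimately have "has_bochner_integral std_normal_distribution
      (\<lambda>x. indicator {..a} x *\<^sub>R 1
        + exp (t * of_real \<mu>) * (indicator {a<..} x *\<^sub>R exp (t * of_real \<sigma> * of_real x)))
      (std_normal_cdf_complex (of_real a) + exp (t * of_real \<mu>) * (exp ((t * of_real \<sigma>)\<^sup>2 / 2)
        * (1 - std_normal_cdf_complex (of_real a - t * of_real \<sigma>))))"
    by (rule has_bochner_integral_add)
  moreover have "indicator {..a} x *\<^sub>R 1
        + exp (t * of_real \<mu>) * (indicator {a<..} x *\<^sub>R exp (t * of_real \<sigma> * of_real x))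
      = exp (t * of_real (max 0 (\<mu> + \<sigma> * x)))" for x
  proof (cases "x \<le> a")
    case True
    then have "\<mu> + \<sigma> * x \<le> 0"
      using assms by (simp add: a_def field_simps)
    with True show ?thesis
      by (simp add: max_def)
  next
    case False
    then have "\<mu> + \<sigma> * x > 0"
      using assms by (simp add: a_def field_simps)
    with False show ?thesis
      by (simp add: max_def distrib_left exp_add mult_ac)
  qed
  ultimately show ?thesis
    by (simp only: a_def power_mult_distrib of_real_power mult.assoc)
qed

section \<open>Transfer to the probability space\<close>

text \<open>\<open>has_bochner_integral\<close> carries integrability and value together, so a
  single change of variables serves both the existence and the formula of the moment generating
  function.\<close>

lemma (in prob_space) has_bochner_integral_std_normal_transfer:
  fixes f :: "real \<Rightarrow> 'b::{banach, second_countable_topology}"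
  assumes "distributed M lborel Z std_normal_density" "f \<in> borel_measurable borel"
    and "has_bochner_integral std_normal_distribution f c"
  shows "has_bochner_integral M (\<lambda>\<omega>. f (Z \<omega>)) c"
proof -
  have distr: "distr M lborel Z = std_normal_distribution" and Z: "Z \<in> measurable M lborel"
    using assms(1) by (simp_all add: distributed_def)
  have f: "f \<in> borel_measurable lborel"
    using assms(2) by simp
  show ?thesis
    using assms(3) integrable_distr_eq[OF Z f] integral_distr[OF Z f]
    unfolding distr has_bochner_integral_iff by auto
qed

lemma (in prob_space) has_bochner_integral_mgf_max_normal:
  fixes t :: complex
  assumes "distributed M lborel X (normal_density \<mu> \<sigma>)" "\<sigma> > 0"
  shows "has_bochner_integral M (\<lambda>\<omega>. exp (t * of_real (approx_headway X \<omega>)))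
    (std_normal_cdf_complex (of_real (- \<mu> / \<sigma>)) + exp (t * of_real \<mu>) * exp (t\<^sup>2 * of_real (\<sigma>\<^sup>2) / 2)
      * (1 - std_normal_cdf_complex (of_real (- \<mu> / \<sigma>) - t * of_real \<sigma>)))"
proof -
  \<comment> \<open>With this standardised variable as \<open>Z\<close>,
    \<open>\<mu> + \<sigma> * Z\<close> is \<open>X\<close> again.\<close>
  have "distributed M lborel (\<lambda>\<omega>. (X \<omega> - \<mu>) / \<sigma>) std_normal_density"
    using assms normal_standard_normal_convert by blast
  from has_bochner_integral_std_normal_transfer[OF this _
      has_bochner_integral_exp_max_normal[OF assms(2), of t \<mu>]]
  show ?thesis
    using assms(2) by (simp add: approx_headway_def)
qed

text \<open>At a real argument the complex integrand is the embedding of the real one, so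
  integrability and value descend to the reals.\<close>

lemma mgf_of_real:
  fixes t :: real
  assumes "has_bochner_integral M (\<lambda>\<omega>. exp (complex_of_real t * of_real (Y \<omega>))) (of_real c)"
  shows "mgf_exists M Y t \<and> mgf M Y t = c"
proof -
  have eq: "exp (complex_of_real t * of_real y) = of_real (exp (t * y))" for y
    by (simp flip: exp_of_real)
  show ?thesis
    using assms unfolding eq
    by (simp add: has_bochner_integral_iff mgf_def mgf_exists_def complex_of_real_integrable_eq)
qed

theorem proposition9:
  fixes M :: "'a measure" and X :: "'a \<Rightarrow> real"
    and H F \<gamma> \<theta> :: real and T :: "nat \<Rightarrow> real" and N n :: nat
  assumes "prob_space M"
    and "H > 0" and "F > 0" and "\<gamma> \<ge> 0" and "\<theta> > 0"
    and "\<And>k. k \<in> {1..N} \<Longrightarrow> T k > 0"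
    and "n \<in> {1..N}"
    and "X \<in> borel_measurable M"
    and "\<gamma> > 0 \<Longrightarrow> distributed M lborel X
           (normal_density (headway_mean H F \<gamma> \<theta> T N) (headway_sd \<gamma> \<theta> T n))"
    and "\<gamma> = 0 \<Longrightarrow> AE \<omega> in M. X \<omega> = H"
  shows
    "(\<gamma> > 0 \<longrightarrow>
       (\<forall>t::real.
          mgf_exists M (approx_headway X) t \<and>
          mgf M (approx_headway X) t =
            std_normal_cdf (- (H * \<theta> + 2 * \<gamma> * T N / F) / (2 * sqrt (T n * \<gamma>)))
            + exp (t * (H + 2 * \<gamma> * T N / (\<theta> * F))) * exp (\<gamma> * T n * (2 * t\<^sup>2 / \<theta>\<^sup>2))
              * (1 - std_normal_cdf (- (H * \<theta> + 2 * \<gamma> * T N / F) / (2 * sqrt (T n * \<gamma>))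
                                     - 2 * t * sqrt (T n * \<gamma>) / \<theta>))) \<and>
       (\<forall>t::complex.
          mgf_exists M (approx_headway X) t \<and>
          mgf M (approx_headway X) t =
            std_normal_cdf_complex
              (of_real (- (H * \<theta> + 2 * \<gamma> * T N / F) / (2 * sqrt (T n * \<gamma>))))
            + exp (t * of_real (H + 2 * \<gamma> * T N / (\<theta> * F)))
              * exp (of_real (\<gamma> * T n) * (2 * t\<^sup>2 / of_real (\<theta>\<^sup>2)))
              * (1 - std_normal_cdf_complex
                       (of_real (- (H * \<theta> + 2 * \<gamma> * T N / F) / (2 * sqrt (T n * \<gamma>)))
                        - 2 * t * of_real (sqrt (T n * \<gamma>)) / of_real \<theta>)))) \<and>
     (\<gamma> = 0 \<longrightarrow>
       (AE \<omega> in M. approx_headway X \<omega> = H) \<and>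
       (\<forall>t::real. mgf_exists M (approx_headway X) t \<and>
          mgf M (approx_headway X) t = exp (t * H)) \<and>
       (\<forall>t::complex. mgf_exists M (approx_headway X) t \<and>
          mgf M (approx_headway X) t = exp (t * of_real H)))"
proof (intro conjI impI)
  interpret prob_space M by fact
  define \<mu> \<sigma> where "\<mu> = headway_mean H F \<gamma> \<theta> T N" and "\<sigma> = headway_sd \<gamma> \<theta> T n"
  {
    assume "\<gamma> > 0"
    have "T n > 0"
      using assms(6,7) by blast
    then have root: "sqrt (T n * \<gamma>) > 0"
      using \<open>\<gamma> > 0\<close> by simp
    then have "\<sigma> > 0"
      using \<open>\<theta> > 0\<close> by (simp add: \<sigma>_def headway_sd_def)
    have \<mu>: "H + 2 * \<gamma> * T N / (\<theta> * F) = \<mu>"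
      by (simp add: \<mu>_def headway_mean_def)
    \<comment> \<open>The quotient in the claim is \<open>- \<mu> / \<sigma>\<close> expanded by
      \<open>\<theta>\<close>, as
      \<open>\<theta> * \<sigma> = 2 * sqrt (T n * \<gamma>)\<close>.\<close>
    have "H * \<theta> + 2 * \<gamma> * T N / F = \<theta> * \<mu>"
      using \<open>\<theta> > 0\<close> \<open>F > 0\<close> by (simp add: \<mu>_def headway_mean_def field_simps)
    then have ratio: "- (H * \<theta> + 2 * \<gamma> * T N / F) / (2 * sqrt (T n * \<gamma>)) = - \<mu> / \<sigma>"
      by (simp add: \<sigma>_def headway_sd_def mult_ac)
    have var: "\<sigma>\<^sup>2 = 4 * (T n * \<gamma>) / \<theta>\<^sup>2"
      using \<open>T n > 0\<close> \<open>\<gamma> > 0\<close>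
      by (simp add: \<sigma>_def headway_sd_def power_divide power_mult_distrib)
    have real_var: "\<gamma> * T n * (2 * t\<^sup>2 / \<theta>\<^sup>2) = t\<^sup>2 * \<sigma>\<^sup>2 / 2" for t
      by (simp add: var mult_ac)
    have real_shift: "2 * t * sqrt (T n * \<gamma>) / \<theta> = t * \<sigma>" for t
      by (simp add: \<sigma>_def headway_sd_def mult_ac)
    have complex_var: "of_real (\<gamma> * T n) * (2 * t\<^sup>2 / of_real (\<theta>\<^sup>2)) = t\<^sup>2 * of_real (\<sigma>\<^sup>2) / 2" for t :: complex
      by (simp add: var mult_ac)
    have complex_shift: "2 * t * of_real (sqrt (T n * \<gamma>)) / of_real \<theta> = t * of_real \<sigma>" for t :: complex
      by (simp add: \<sigma>_def headway_sd_def mult_ac)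
    have main: "has_bochner_integral M (\<lambda>\<omega>. exp (t * of_real (approx_headway X \<omega>)))
      (std_normal_cdf_complex (of_real (- \<mu> / \<sigma>)) + exp (t * of_real \<mu>) * exp (t\<^sup>2 * of_real (\<sigma>\<^sup>2) / 2)
        * (1 - std_normal_cdf_complex (of_real (- \<mu> / \<sigma>) - t * of_real \<sigma>)))" for t :: complex
      using assms(9)[OF \<open>\<gamma> > 0\<close>] \<open>\<sigma> > 0\<close> unfolding \<mu>_def \<sigma>_def
      by (rule has_bochner_integral_mgf_max_normal)
    show "\<forall>t::real.
          mgf_exists M (approx_headway X) t \<and>
          mgf M (approx_headway X) t =
            std_normal_cdf (- (H * \<theta> + 2 * \<gamma> * T N / F) / (2 * sqrt (T n * \<gamma>)))
            + exp (t * (H + 2 * \<gamma> * T N / (\<theta> * F))) * exp (\<gamma> * T n * (2 * t\<^sup>2 / \<theta>\<^sup>2))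
              * (1 - std_normal_cdf (- (H * \<theta> + 2 * \<gamma> * T N / F) / (2 * sqrt (T n * \<gamma>))
                                     - 2 * t * sqrt (T n * \<gamma>) / \<theta>))"
      unfolding ratio \<mu> real_var real_shift
    proof (intro allI mgf_of_real)
      fix t :: real
      \<comment> \<open>For real \<open>t\<close> the shifted argument stays on the real axis, where
        the continuation agrees with \<open>std_normal_cdf\<close>.\<close>
      have "std_normal_cdf_complex (of_real (- \<mu> / \<sigma>) - of_real t * of_real \<sigma>)
          = of_real (std_normal_cdf (- \<mu> / \<sigma> - t * \<sigma>))"
        using std_normal_cdf_complex_of_real[of "- \<mu> / \<sigma> - t * \<sigma>"] by simp
      moreover have "exp (complex_of_real t * of_real \<mu>) = of_real (exp (t * \<mu>))"
        "exp ((complex_of_real t)\<^sup>2 * of_real (\<sigma>\<^sup>2) / 2) = of_real (exp (t\<^sup>2 * \<sigma>\<^sup>2 / 2))"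
        by (simp_all flip: exp_of_real)
      ultimately show "has_bochner_integral M
          (\<lambda>\<omega>. exp (complex_of_real t * of_real (approx_headway X \<omega>)))
          (of_real (std_normal_cdf (- \<mu> / \<sigma>) + exp (t * \<mu>) * exp (t\<^sup>2 * \<sigma>\<^sup>2 / 2)
            * (1 - std_normal_cdf (- \<mu> / \<sigma> - t * \<sigma>))))"
        using main[of "of_real t"]
        by (simp only: std_normal_cdf_complex_of_real of_real_add of_real_mult of_real_diff of_real_1)
    qed
    show "\<forall>t::complex.
          mgf_exists M (approx_headway X) t \<and>
          mgf M (approx_headway X) t =
            std_normal_cdf_complex
              (of_real (- (H * \<theta> + 2 * \<gamma> * T N / F) / (2 * sqrt (T n * \<gamma>))))
            + exp (t * of_real (H + 2 * \<gamma> * T N / (\<theta> * F)))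
              * exp (of_real (\<gamma> * T n) * (2 * t\<^sup>2 / of_real (\<theta>\<^sup>2)))
              * (1 - std_normal_cdf_complex
                       (of_real (- (H * \<theta> + 2 * \<gamma> * T N / F) / (2 * sqrt (T n * \<gamma>)))
                        - 2 * t * of_real (sqrt (T n * \<gamma>)) / of_real \<theta>))"
      unfolding ratio \<mu> complex_var complex_shift
      using main by (simp only: mgf_def mgf_exists_def has_bochner_integral_iff) blast
  }
  {
    assume "\<gamma> = 0"
    \<comment> \<open>Since \<open>H\<close> is positive, taking the positive part leaves it
      unchanged.\<close>
    show ae: "AE \<omega> in M. approx_headway X \<omega> = H"
      using assms(10)[OF \<open>\<gamma> = 0\<close>] \<open>H > 0\<close>
      by (auto simp: approx_headway_def elim!: eventually_mono)
    \<comment> \<open>Almost sure equality with a constant transfers the integral only to a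
      measurable integrand.\<close>
    have [measurable]: "approx_headway X \<in> borel_measurable M"
      using assms(8) by (simp add: approx_headway_def[abs_def])
    have const: "has_bochner_integral M (\<lambda>\<omega>. exp (t * of_real (approx_headway X \<omega>))) (exp (t * of_real H))"
      for t :: complex
    proof (rule has_bochner_integralI_AE)
      show "has_bochner_integral M (\<lambda>_. exp (t * of_real H)) (exp (t * of_real H))"
        by (simp add: has_bochner_integral_iff prob_space)
    qed (use ae in auto)
    show "\<forall>t::real. mgf_exists M (approx_headway X) t \<and> mgf M (approx_headway X) t = exp (t * H)"
      using const by (auto intro!: mgf_of_real simp flip: exp_of_real)
    show "\<forall>t::complex. mgf_exists M (approx_headway X) t \<and>
        mgf M (approx_headway X) t = exp (t * of_real H)"
      using const by (simp add: mgf_def mgf_exists_def has_bochner_integral_iff)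
  }
qed

end
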